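(* Speculation is strictly more profitable in second-price auctions than in first-price auctions. That is, $$\max_{v\in[0,r]}\Pi^*(v)>\max_{v\in[0,r]}\Pi^\star(v),$$ where $\Pi^*(v)$ and $\Pi^\star(v)$ are the speculator's expected profits when he induces the acceptance cutoff $v$ in the second-price-auction and in the first-price-auction speculation game respectively.
   Context: Setting. $N\ge2$ sellers each own one item; their private values are drawn independently from a CDF $F$ on $[0,1]$ with a density $f$, and $F(0)=0<F(v)$ for all $v\in(0,1]$. An auctioneer buys one item by a reverse auction with reserve price $r\in(0,1]$ (second-price: the lowest bid not exceeding $r$ wins and is paid the minimum of $r$ and the lowest competing bid; first-price: the lowest bid not exceeding $r$ wins and is paid its bid). Before the auction a speculator (who has value $0$ for items) offers every seller a price $p\in[0,r]$; sellers simultaneously accept or reject; then the auction is held among the sellers who rejected and the speculator (if he acquired at least one item; he offers one item and withholds the rest). The speculator's profit is his auction revenue minus his acquisition payments. In equilibrium sellers accept if and only if their value is below a cutoff $v\in[0,r]$, and choosing $p$ amounts to choosing the cutoff $v$. Second-price auction (in the auction sellers bid truthfully and the speculator bids $0$ for one item and withholds the rest): cutoff $v$ corresponds to the acquisition price $p^*(v)$, with $$p^*(v)=v+\int_v^r[1-F(x)]^{N-1}dx,\qquad y(m,v)=v+\int_v^r\Big[\tfrac{1-F(x)}{1-F(v)}\Big]^mdx,$$ $$\Pi^*(v)=\sum_{m=0}^{N-1}\binom Nm[F(v)]^{N-m}[1-F(v)]^m\,y(m,v)-N F(v)p^*(v).$$ First-price auction (symmetric perfect Bayesian equilibria in which nobody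 bids below his value): with $G(b;v)=\frac{F(b)-F(v)}{1-F(v)}$ and $\underline b(m,v)=\max_{v\le b\le r}b[1-G(b;v)]^m$, cutoff $v$ corresponds to the acquisition price $$p^\star(v)=v+\int_v^r[1-F(x)]^{N-1}dx+\sum_{m=0}^{N-2}\binom{N-1}{m}[1-F(v)]^m[F(v)]^{N-1-m}\big[\underline b(m+1,v)-v\big],$$ and $$\Pi^\star(v)=\sum_{m=1}^{N-1}\binom Nm[1-F(v)]^m[F(v)]^{N-m}\,\underline b(m,v)+[F(v)]^N r-N F(v)\,p^\star(v).$$
   Formalization: The formal statement additionally assumes F(v)<1 for all cutoffs 0≤v<r; if F reaches 1 below r, G(b;v) is 0/0 there, so the first-price profit is undefined on part of [0,r], and strictness can fail for its limiting values. *)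

theory Defs
  imports "HOL-Probability.Probability"
begin

text \<open>Throughout, \<open>N\<close> is the number of sellers, \<open>F\<close> the CDF of each seller's value, \<open>r\<close> the
  reserve price and \<open>v\<close> the acceptance cutoff.  The index \<open>m\<close> counts the sellers who reject the
  speculator's offer and therefore compete with him in the auction.\<close>

subsection \<open>Second-price auction\<close>

definition spa_price :: "nat \<Rightarrow> (real \<Rightarrow> real) \<Rightarrow> real \<Rightarrow> real \<Rightarrow> real" where
  "spa_price N F r v = v + integral {v..r} (\<lambda>x. (1 - F x) ^ (N - 1))"

text \<open>For \<open>m = 0\<close> the integrand is 1, so the revenue is \<open>r\<close>.  If \<open>F v = 1\<close>, the quotient is
  \<open>0\<close> by totalised division, but every term with \<open>m \<ge> 1\<close> then has weight 0 in \<open>spa_profit\<close>.\<close>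

definition spa_revenue :: "(real \<Rightarrow> real) \<Rightarrow> real \<Rightarrow> nat \<Rightarrow> real \<Rightarrow> real" where
  "spa_revenue F r m v = v + integral {v..r} (\<lambda>x. ((1 - F x) / (1 - F v)) ^ m)"

definition spa_profit :: "nat \<Rightarrow> (real \<Rightarrow> real) \<Rightarrow> real \<Rightarrow> real \<Rightarrow> real" where
  "spa_profit N F r v =
     (\<Sum>m=0..N-1. real (N choose m) * F v ^ (N - m) * (1 - F v) ^ m * spa_revenue F r m v)
     - real N * F v * spa_price N F r v"

subsection \<open>First-price auction\<close>

definition rejector_cdf :: "(real \<Rightarrow> real) \<Rightarrow> real \<Rightarrow> real \<Rightarrow> real" where
  "rejector_cdf F v b = (F b - F v) / (1 - F v)"

text \<open>The supremum is a maximum for continuous \<open>F\<close>, see \<open>lowest_bid_attained\<close>.  At \<open>v = r\<close> the value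
  is \<open>r\<close>, also when \<open>F r = 1\<close>, since then \<open>rejector_cdf F r r = 0\<close>.\<close>

definition lowest_bid :: "(real \<Rightarrow> real) \<Rightarrow> real \<Rightarrow> nat \<Rightarrow> real \<Rightarrow> real" where
  "lowest_bid F r m v = (SUP b\<in>{v..r}. b * (1 - rejector_cdf F v b) ^ m)"

lemma lowest_bid_attained:
  assumes "v \<le> r" and "continuous_on {v..r} F"
  shows "\<exists>b\<in>{v..r}. lowest_bid F r m v = b * (1 - rejector_cdf F v b) ^ m \<and>
    (\<forall>c\<in>{v..r}. c * (1 - rejector_cdf F v c) ^ m \<le> b * (1 - rejector_cdf F v b) ^ m)"
proof -
  let ?g = "\<lambda>b. b * (1 - rejector_cdf F v b) ^ m"
  have "continuous_on {v..r} ?g"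
    unfolding rejector_cdf_def divide_inverse by (intro continuous_intros assms(2))
  then obtain b where b: "b \<in> {v..r}" "\<forall>c\<in>{v..r}. ?g c \<le> ?g b"
    using continuous_attains_sup[of "{v..r}" ?g] assms(1) by auto
  have "lowest_bid F r m v = ?g b"
    unfolding lowest_bid_def using b by (intro cSup_eq_maximum) auto
  then show ?thesis using b by blast
qed

definition fpa_price :: "nat \<Rightarrow> (real \<Rightarrow> real) \<Rightarrow> real \<Rightarrow> real \<Rightarrow> real" where
  "fpa_price N F r v =
     v + integral {v..r} (\<lambda>x. (1 - F x) ^ (N - 1))
     + (\<Sum>m=0..N-2. real ((N - 1) choose m) * (1 - F v) ^ m * F v ^ (N - 1 - m)
          * (lowest_bid F r (m + 1) v - v))"

definition fpa_profit :: "nat \<Rightarrow> (real \<Rightarrow> real) \<Rightarrow> real \<Rightarrow> real \<Rightarrow> real" where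
  "fpa_profit N F r v =
     (\<Sum>m=1..N-1. real (N choose m) * (1 - F v) ^ m * F v ^ (N - m) * lowest_bid F r m v)
     + F v ^ N * r - real N * F v * fpa_price N F r v"

end

theory Submission
  imports Defs
begin

text \<open>At a common cutoff \<open>v\<close> with \<open>0 < v < r\<close> the second-price auction does better on both sides of
  the ledger.  Its revenue \<open>y m v\<close> against \<open>m\<close> rejectors is at least the lowest equilibrium bid
  \<open>b m v\<close>, because \<open>v + \<integral>\<^sub>v\<^sup>r (1 - G)\<^sup>m \<ge> v + (b - v) (1 - G b)\<^sup>m \<ge> b (1 - G b)\<^sup>m\<close>; its acquisition price
  is lower because \<open>b m v \<ge> v\<close>.  The gaps \<open>y 1 v - b 1 v\<close> and \<open>b 1 v - v\<close> cannot both vanish, since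
  \<open>y 1 v > v\<close>.  At the end points the first-price profit is nonpositive, whereas the
  second-price profit at a small cutoff is at least
  \<open>N (N - 1) (F v)\<^sup>2 (\<integral>\<^sub>v\<^sup>r (1 - F)\<^bsup>N - 2\<^esup> / 2 - v) > 0\<close>.\<close>

section \<open>Continuity of tail suprema, tail integrals and squeezed functions\<close>

text \<open>Moving the left end from \<open>u\<close> down to \<open>v\<close> with
  \<open>u - v < d\<close> adds only points of \<open>{v..<u}\<close>. There uniform continuity
  keeps \<open>h\<close> within \<open>e\<close> of \<open>h u\<close>, which is at most the
  supremum over \<open>{u..r}\<close>, so this antitone function of the left end moves by less than
  \<open>e\<close>.\<close>

lemma continuous_on_Sup_tail:
  fixes h :: "real \<Rightarrow> real"
  assumes "continuous_on {a..r} h"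
  shows "continuous_on {a..r} (\<lambda>v. SUP b\<in>{v..r}. h b)"
proof -
  let ?H = "\<lambda>v. SUP b\<in>{v..r}. h b"
  have att: "\<exists>b\<in>{v..r}. ?H v = h b \<and> (\<forall>c\<in>{v..r}. h c \<le> h b)" if "v \<in> {a..r}" for v
  proof -
    have "continuous_on {v..r} h"
      using assms by (rule continuous_on_subset) (use that in auto)
    moreover have "{v..r} \<noteq> {}" using that by simp
    ultimately obtain b where b: "b \<in> {v..r}" "\<forall>c\<in>{v..r}. h c \<le> h b"
      using continuous_attains_sup[OF compact_Icc] by metis
    moreover have "?H v = h b"
      using b by (intro cSup_eq_maximum) auto
    ultimately show ?thesis by blast
  qed
  have ge: "h c \<le> ?H v" if "v \<in> {a..r}" "c \<in> {v..r}" for v c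
    using att[OF that(1)] that(2) by auto
  have anti: "?H u \<le> ?H v" if "a \<le> v" "v \<le> u" "u \<le> r" for u v
    using att[of u] ge[of v] that by force
  have unif: "uniformly_continuous_on {a..r} h"
    using assms by (rule compact_uniformly_continuous) auto
  show ?thesis
  proof (rule uniformly_continuous_imp_continuous, unfold uniformly_continuous_on_def, safe)
    fix e :: real assume "e > 0"
    then obtain d where d: "d > 0" "\<And>x y. x \<in> {a..r} \<Longrightarrow> y \<in> {a..r} \<Longrightarrow> dist y x < d \<Longrightarrow> dist (h y) (h x) < e"
      using unif unfolding uniformly_continuous_on_def by metis
    have close: "?H v < ?H u + e" if "a \<le> v" "v \<le> u" "u \<le> r" "u - v < d" for u v
    proof -
      have "v \<in> {a..r}" using that by simp
      then obtain b where b: "b \<in> {v..r}" "?H v = h b" using att by blast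
      show ?thesis
      proof (cases "u \<le> b")
        case True
        then show ?thesis using ge[of u b] b that \<open>e > 0\<close> by auto
      next
        case False
        then have "dist (h b) (h u) < e"
          using that b by (intro d(2)) (auto simp: dist_real_def)
        then show ?thesis using ge[of u u] b that by (auto simp: dist_real_def)
      qed
    qed
    have "dist (?H y) (?H x) < e" if "x \<in> {a..r}" "y \<in> {a..r}" "dist y x < d" for x y
    proof (cases "x \<le> y")
      case True
      then show ?thesis using close[of x y] anti[of x y] that by (auto simp: dist_real_def)
    next
      case False
      then show ?thesis using close[of y x] anti[of y x] that by (auto simp: dist_real_def)
    qed
    then show "\<exists>d>0. \<forall>x\<in>{a..r}. \<forall>x'\<in>{a..r}. dist x' x < d \<longrightarrow> dist (?H x') (?H x) < e"
      using d(1) by blast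
  qed
qed

lemma continuous_on_integral_tail:
  fixes g :: "real \<Rightarrow> real"
  assumes "continuous_on {a..r} g"
  shows "continuous_on {a..r} (\<lambda>v. integral {v..r} g)"
  by (rule indefinite_integral_continuous_1') (rule integrable_continuous_real[OF assms])

text \<open>Revenue and lowest bid divide by a power of \<open>1 - F v\<close>, which may vanish at
  \<open>v = r\<close>. Continuity there comes instead from \<open>v \<le> g v \<le> r\<close>,
  which pinches \<open>g\<close> to \<open>r\<close>.\<close>

lemma continuous_on_squeeze_right_end:
  fixes g :: "real \<Rightarrow> real"
  assumes "a \<le> r" and cont: "continuous_on {a..<r} g"
    and lower: "\<And>v. v \<in> {a..r} \<Longrightarrow> v \<le> g v" and upper: "\<And>v. v \<in> {a..r} \<Longrightarrow> g v \<le> r"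
  shows "continuous_on {a..r} g"
  unfolding continuous_on_def
proof
  fix x assume x: "x \<in> {a..r}"
  show "(g \<longlongrightarrow> g x) (at x within {a..r})"
  proof (cases "x = r")
    case True
    have "g r = r" using lower[of r] upper[of r] \<open>a \<le> r\<close> by auto
    moreover have "(g \<longlongrightarrow> r) (at r within {a..r})"
      by (rule tendsto_sandwich[of "\<lambda>v. v" _ _ "\<lambda>_. r"])
        (auto simp: eventually_at_filter intro!: always_eventually lower upper)
    ultimately show ?thesis using True by simp
  next
    case False
    have "at x within {a..<r} = at x within {a..r}"
      by (rule at_within_nhd[of _ "{..<r}"]) (use False x in auto)
    moreover have "x \<in> {a..<r}" using False x by auto
    ultimately show ?thesis using cont unfolding continuous_on_def by metis
  qed
qed

section \<open>Bounds on bids and revenues at a fixed cutoff\<close>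

text \<open>\<open>F r = 1\<close> is allowed: division by \<open>1 - F v\<close> is safe only for
  \<open>v\<close> in \<open>{0..<r}\<close>, and the right end gets separate treatment.\<close>

locale value_cdf =
  fixes F :: "real \<Rightarrow> real" and r :: real
  assumes r_pos: "0 < r"
    and cont: "continuous_on {0..r} F"
    and F_mono: "\<And>x y. x \<le> y \<Longrightarrow> F x \<le> F y"
    and F_le_1: "\<And>x. F x \<le> 1"
    and F_0: "F 0 = 0"
    and F_pos: "\<And>v. 0 < v \<Longrightarrow> v \<le> r \<Longrightarrow> 0 < F v"
    and F_less_1: "\<And>v. 0 \<le> v \<Longrightarrow> v < r \<Longrightarrow> F v < 1"
begin

lemma F_nonneg: "0 \<le> v \<Longrightarrow> 0 \<le> F v"
  using F_mono[of 0 v] F_0 by simp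

lemma cont_tail: "0 \<le> v \<Longrightarrow> continuous_on {v..r} F"
  using cont by (rule continuous_on_subset) auto

lemma integrable_survival_power:
  "0 \<le> v \<Longrightarrow> w \<le> r \<Longrightarrow> (\<lambda>x. ((1 - F x) / c) ^ m) integrable_on {v..w}"
  unfolding divide_inverse
  by (intro integrable_continuous_real continuous_intros continuous_on_subset[OF cont]) auto

lemma survival_ratio_bounds:
  assumes "v \<le> x"
  shows "0 \<le> (1 - F x) / (1 - F v)" "(1 - F x) / (1 - F v) \<le> 1"
  using F_mono[OF assms] F_le_1[of x] F_le_1[of v] by (auto simp: divide_le_eq_1)

lemma survival_ratio_eq:
  assumes "0 \<le> v" "v < r"
  shows "1 - rejector_cdf F v b = (1 - F b) / (1 - F v)"
  using F_less_1[OF assms] by (simp add: rejector_cdf_def field_simps)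

lemma lowest_bid_upper:
  assumes "0 \<le> v" "v \<le> r" "b \<in> {v..r}"
  shows "b * (1 - rejector_cdf F v b) ^ m \<le> lowest_bid F r m v"
  using lowest_bid_attained[OF assms(2) cont_tail[OF assms(1)], of m] assms(3) by auto

lemma lowest_bid_ge_cutoff:
  assumes "0 \<le> v" "v \<le> r"
  shows "v \<le> lowest_bid F r m v"
  using lowest_bid_upper[OF assms, of v m] assms by (simp add: rejector_cdf_def)

text \<open>The survival power decreases, so on \<open>{v..b}\<close> it is at least its value at
  \<open>b\<close>, and the part over \<open>{b..r}\<close> is nonnegative. The divisor
  \<open>c\<close> is \<open>1 - F v\<close> for revenues and \<open>1\<close> for the unnormalised
  integral.\<close>

lemma integral_lower_bound:
  assumes "0 \<le> v" "v \<le> b" "b \<le> r" "0 \<le> c"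
  shows "(b - v) * ((1 - F b) / c) ^ m \<le> integral {v..r} (\<lambda>x. ((1 - F x) / c) ^ m)"
proof -
  have nonneg: "0 \<le> (1 - F x) / c" for x using F_le_1[of x] assms(4) by simp
  have "(b - v) * ((1 - F b) / c) ^ m = integral {v..b} (\<lambda>x. ((1 - F b) / c) ^ m)"
    using assms(2) by simp
  also have "\<dots> \<le> integral {v..b} (\<lambda>x. ((1 - F x) / c) ^ m)"
    using assms nonneg
    by (intro integral_le integrable_survival_power power_mono divide_right_mono)
      (auto intro: F_mono)
  also have "\<dots> \<le> integral {v..r} (\<lambda>x. ((1 - F x) / c) ^ m)"
    using assms nonneg by (intro integral_subset_le integrable_survival_power) auto
  finally show ?thesis .
qed

lemma spa_revenue_le:
  assumes "0 \<le> v" "v \<le> r"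
  shows "spa_revenue F r m v \<le> r"
proof -
  have "integral {v..r} (\<lambda>x. ((1 - F x) / (1 - F v)) ^ m) \<le> integral {v..r} (\<lambda>x. 1)"
    using assms
    by (intro integral_le integrable_survival_power power_le_one survival_ratio_bounds) auto
  then show ?thesis using assms by (simp add: spa_revenue_def)
qed

lemma lowest_bid_le_spa_revenue:
  assumes "0 \<le> v" "v \<le> r"
  shows "lowest_bid F r m v \<le> spa_revenue F r m v"
proof (cases "v = r")
  case True
  \<comment> \<open>Both sides equal \<open>r\<close> here; \<open>survival_ratio_eq\<close> is
    available only below \<open>r\<close>.\<close>
  then show ?thesis by (simp add: lowest_bid_def spa_revenue_def rejector_cdf_def)
next
  case False
  then have "v < r" using assms by simp
  obtain b where b: "b \<in> {v..r}" "lowest_bid F r m v = b * (1 - rejector_cdf F v b) ^ m"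
    using lowest_bid_attained[OF assms(2) cont_tail[OF assms(1)]] by blast
  define q where "q = ((1 - F b) / (1 - F v)) ^ m"
  have "q \<le> 1" unfolding q_def using b survival_ratio_bounds[of v b] by (intro power_le_one) auto
  then have "v * q \<le> v" using assms(1) by (rule mult_left_le)
  moreover have "lowest_bid F r m v = b * q"
    using b survival_ratio_eq[OF assms(1) \<open>v < r\<close>] by (simp add: q_def)
  moreover have "(b - v) * q \<le> integral {v..r} (\<lambda>x. ((1 - F x) / (1 - F v)) ^ m)"
    unfolding q_def using b assms F_le_1[of v] by (intro integral_lower_bound) auto
  ultimately show ?thesis by (simp add: spa_revenue_def algebra_simps)
qed

lemma cutoff_less_spa_revenue:
  assumes "0 \<le> v" "v < r"
  shows "v < spa_revenue F r m v"
proof -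
  \<comment> \<open>Staying below \<open>r\<close> gives \<open>F b < 1\<close>, so the bound is
    strictly positive even when \<open>F r = 1\<close>.\<close>
  obtain b where b: "v < b" "b < r" using dense[OF assms(2)] by blast
  have "0 < (b - v) * ((1 - F b) / (1 - F v)) ^ m"
    using b assms F_less_1[of b] F_less_1[of v] by simp
  also have "\<dots> \<le> integral {v..r} (\<lambda>x. ((1 - F x) / (1 - F v)) ^ m)"
    using b assms F_le_1[of v] by (intro integral_lower_bound) auto
  finally show ?thesis by (simp add: spa_revenue_def)
qed

section \<open>Continuity of the profits in the cutoff\<close>

text \<open>Below \<open>r\<close> the factor \<open>1 / (1 - F v) ^ m\<close> comes out of the
  supremum. The remaining objective does not depend on \<open>v\<close>, so
  \<open>continuous_on_Sup_tail\<close> applies.\<close>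

lemma continuous_on_lowest_bid: "continuous_on {0..r} (lowest_bid F r m)"
proof (rule continuous_on_squeeze_right_end)
  let ?h = "\<lambda>b. b * (1 - F b) ^ m"
  have "continuous_on {0..r} (\<lambda>v. SUP b\<in>{v..r}. ?h b)"
    by (intro continuous_on_Sup_tail continuous_intros cont)
  then have "continuous_on {0..<r} (\<lambda>v. (SUP b\<in>{v..r}. ?h b) / (1 - F v) ^ m)"
    using F_less_1
    by (intro continuous_intros) (fastforce intro: continuous_on_subset continuous_on_subset[OF cont])+
  moreover have "lowest_bid F r m v = (SUP b\<in>{v..r}. ?h b) / (1 - F v) ^ m"
    if "v \<in> {0..<r}" for v
  proof -
    have pos: "0 < (1 - F v) ^ m" using F_less_1[of v] that by simp
    have eq: "b * (1 - rejector_cdf F v b) ^ m = ?h b / (1 - F v) ^ m" for b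
      using survival_ratio_eq[of v b] that by (simp add: power_divide)
    have "v \<le> r" "continuous_on {v..r} F" using that cont_tail by auto
    then obtain b where b: "b \<in> {v..r}" "lowest_bid F r m v = ?h b / (1 - F v) ^ m"
      "\<forall>c\<in>{v..r}. ?h c / (1 - F v) ^ m \<le> ?h b / (1 - F v) ^ m"
      using lowest_bid_attained[of v r F m] unfolding eq by blast
    have "(SUP b\<in>{v..r}. ?h b) = ?h b"
      using b pos by (intro cSup_eq_maximum) (auto simp: divide_le_cancel)
    then show ?thesis using b by simp
  qed
  ultimately show "continuous_on {0..<r} (lowest_bid F r m)"
    by (subst continuous_on_cong[OF refl])
next
  show "v \<le> lowest_bid F r m v" "lowest_bid F r m v \<le> r" if "v \<in> {0..r}" for v
    using lowest_bid_ge_cutoff[of v m] lowest_bid_le_spa_revenue[of v m] spa_revenue_le[of v m] that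
    by auto
qed (use r_pos in simp)

lemma continuous_on_spa_revenue: "continuous_on {0..r} (spa_revenue F r m)"
proof (rule continuous_on_squeeze_right_end)
  let ?I = "\<lambda>v. integral {v..r} (\<lambda>x. (1 - F x) ^ m)"
  have "continuous_on {0..r} ?I"
    by (intro continuous_on_integral_tail continuous_intros cont)
  then have "continuous_on {0..<r} (\<lambda>v. v + ?I v / (1 - F v) ^ m)"
    using F_less_1
    by (intro continuous_intros) (fastforce intro: continuous_on_subset continuous_on_subset[OF cont])+
  moreover have "spa_revenue F r m v = v + ?I v / (1 - F v) ^ m" for v
    by (simp add: spa_revenue_def power_divide)
  ultimately show "continuous_on {0..<r} (spa_revenue F r m)" by simp
next
  show "v \<le> spa_revenue F r m v" "spa_revenue F r m v \<le> r" if "v \<in> {0..r}" for v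
    using lowest_bid_ge_cutoff[of v m] lowest_bid_le_spa_revenue[of v m] spa_revenue_le[of v m] that
    by auto
qed (use r_pos in simp)

lemma continuous_on_spa_profit: "continuous_on {0..r} (spa_profit N F r)"
  unfolding spa_profit_def spa_price_def
  by (intro continuous_intros continuous_on_integral_tail continuous_on_spa_revenue cont)

lemma continuous_on_fpa_profit: "continuous_on {0..r} (fpa_profit N F r)"
  unfolding fpa_profit_def fpa_price_def
  by (intro continuous_intros continuous_on_integral_tail continuous_on_lowest_bid cont)

section \<open>Strict comparison at interior cutoffs\<close>

lemma fpa_profit_less_spa_profit:
  assumes N: "2 \<le> N" and v: "0 < v" "v < r"
  shows "fpa_profit N F r v < spa_profit N F r v"
proof -
  define y where "y m = spa_revenue F r m v" for m
  define b where "b m = lowest_bid F r m v" for m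
  define w where "w m = real (N choose m) * F v ^ (N - m) * (1 - F v) ^ m" for m
  define u where "u m = real ((N - 1) choose m) * (1 - F v) ^ m * F v ^ (N - 1 - m)" for m
  have Fv: "0 < F v" "F v < 1" using F_pos[of v] F_less_1[of v] v by auto
  have w_pos: "0 < w m" if "m \<le> N" for m using Fv that by (simp add: w_def)
  have u_pos: "0 < u m" if "m \<le> N - 1" for m using Fv that by (simp add: u_def)
  have b_le_y: "b m \<le> y m" and v_le_b: "v \<le> b m" for m
    using lowest_bid_le_spa_revenue lowest_bid_ge_cutoff v by (auto simp: b_def y_def)
  have y1: "v < y 1" using cutoff_less_spa_revenue v by (auto simp: y_def)
  have y0: "y 0 = r" using v by (simp add: y_def spa_revenue_def)
  \<comment> \<open>The term \<open>m = 0\<close> is peeled off because the first-price profit lists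
    it separately as \<open>F v ^ N * r\<close>.\<close>
  have split: "(\<Sum>m=0..N-1. w m * y m) = F v ^ N * r + (\<Sum>m=1..N-1. w m * y m)"
    using y0 by (subst sum.atLeast_Suc_atMost) (auto simp: w_def)
  have spa: "spa_profit N F r v = F v ^ N * r + (\<Sum>m=1..N-1. w m * y m) - real N * F v * spa_price N F r v"
    unfolding split[symmetric] by (simp add: spa_profit_def w_def y_def)
  have "fpa_price N F r v = spa_price N F r v + (\<Sum>m=0..N-2. u m * (b (m + 1) - v))"
    by (simp add: fpa_price_def spa_price_def u_def b_def)
  then have fpa: "fpa_profit N F r v = (\<Sum>m=1..N-1. w m * b m) + F v ^ N * r
      - real N * F v * (spa_price N F r v + (\<Sum>m=0..N-2. u m * (b (m + 1) - v)))"
    by (simp add: fpa_profit_def w_def b_def mult_ac)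
  \<comment> \<open>All gap terms are nonnegative, so the case of one rejector suffices:
    \<open>m = 1\<close> in the revenue sum and, through the shift to \<open>m + 1\<close>,
    \<open>m = 0\<close> in the price sum. Both indices are in range because
    \<open>2 \<le> N\<close>.\<close>
  have "w 1 * (y 1 - b 1) \<le> (\<Sum>m=1..N-1. w m * (y m - b m))"
    using N by (intro member_le_sum) (auto intro!: mult_nonneg_nonneg less_imp_le[OF w_pos] simp: b_le_y)
  moreover have "u 0 * (b 1 - v) \<le> (\<Sum>m=0..N-2. u m * (b (m + 1) - v))"
    using N member_le_sum[of 0 "{0..N-2}" "\<lambda>m. u m * (b (m + 1) - v)"]
    by (force intro!: mult_nonneg_nonneg less_imp_le[OF u_pos] simp: v_le_b)
  then have "real N * F v * (u 0 * (b 1 - v)) \<le> real N * F v * (\<Sum>m=0..N-2. u m * (b (m + 1) - v))"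
    using Fv by (intro mult_left_mono) auto
  moreover have "0 < w 1 * (y 1 - b 1) + real N * F v * (u 0 * (b 1 - v))"
  proof (cases "b 1 = v")
    case True
    then show ?thesis using y1 w_pos[of 1] N by simp
  next
    case False
    then have "0 < real N * F v * (u 0 * (b 1 - v))"
      using v_le_b[of 1] N Fv u_pos[of 0] by simp
    moreover have "0 \<le> w 1 * (y 1 - b 1)"
      using w_pos[of 1] b_le_y[of 1] N by simp
    ultimately show ?thesis by simp
  qed
  moreover have "(\<Sum>m=1..N-1. w m * (y m - b m)) = (\<Sum>m=1..N-1. w m * y m) - (\<Sum>m=1..N-1. w m * b m)"
    by (simp add: right_diff_distrib sum_subtractf)
  ultimately show ?thesis unfolding spa fpa by (simp add: distrib_left)
qed

section \<open>First-price profit at the end points\<close>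

lemma fpa_profit_0: "2 \<le> N \<Longrightarrow> fpa_profit N F r 0 = 0"
  unfolding fpa_profit_def F_0 by (subst sum.neutral) (auto simp: power_0_left)

text \<open>At cutoff \<open>r\<close> every price and bid is \<open>r\<close>. Revenue accrues with
  probability \<open>1 - (1 - F r) ^ N\<close>, and by Bernoulli's inequality this is at most
  \<open>N * F r\<close>, the expected number of purchases.\<close>

lemma fpa_profit_reserve_nonpos:
  assumes "2 \<le> N"
  shows "fpa_profit N F r r \<le> 0"
proof -
  let ?t = "\<lambda>m. real (N choose m) * (1 - F r) ^ m * F r ^ (N - m)"
  have lb: "lowest_bid F r m r = r" for m by (simp add: lowest_bid_def rejector_cdf_def)
  have "(\<Sum>m\<le>N. ?t m) = 1"
    using binomial_ring[of "1 - F r" "F r" N] by simp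
  moreover have "(\<Sum>m\<le>N. ?t m) = F r ^ N + (\<Sum>m=1..N-1. ?t m) + (1 - F r) ^ N"
  proof -
    obtain n where n: "N = Suc n" using assms by (cases N) auto
    have "(\<Sum>m=0..n. ?t m) = F r ^ N + (\<Sum>m=1..n. ?t m)"
      by (subst sum.atLeast_Suc_atMost) auto
    then show ?thesis using n by (simp add: atLeast0AtMost)
  qed
  moreover have "1 - real N * F r \<le> (1 - F r) ^ N"
    using Bernoulli_inequality[of "- F r" N] F_le_1[of r] by simp
  ultimately have "F r ^ N + (\<Sum>m=1..N-1. ?t m) - real N * F r \<le> 0" by simp
  moreover have "fpa_profit N F r r = r * (F r ^ N + (\<Sum>m=1..N-1. ?t m) - real N * F r)"
    by (simp add: fpa_profit_def fpa_price_def lb algebra_simps sum_distrib_left)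
  ultimately show ?thesis using r_pos by (simp add: mult_nonneg_nonpos)
qed

section \<open>Positive second-price profit at a small cutoff\<close>

text \<open>The weight in the profit cancels the denominator, which leaves unnormalised integrals
  comparable with the one in \<open>spa_price\<close>.\<close>

lemma survival_power_times_spa_revenue:
  assumes "F v \<noteq> 1"
  shows "(1 - F v) ^ m * spa_revenue F r m v
    = (1 - F v) ^ m * v + integral {v..r} (\<lambda>x. (1 - F x) ^ m)"
  using assms by (simp add: spa_revenue_def power_divide distrib_left)

text \<open>Only the revenue terms \<open>m = N - 2\<close> and \<open>m = N - 1\<close> are kept.
  The last one offsets the acquisition cost up to second order in \<open>F v\<close>; the one before
  it supplies a positive term of that same order.\<close>

lemma spa_profit_lower_bound:
  assumes N: "2 \<le> N" and v: "0 < v" "v < r"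
  shows "real N * real (N - 1) * (F v)\<^sup>2 * (integral {v..r} (\<lambda>x. (1 - F x) ^ (N - 2)) / 2 - v)
    \<le> spa_profit N F r v"
proof -
  obtain n where n: "N = Suc (Suc n)" using N by (metis Suc_le_D numeral_2_eq_2 Suc_le_mono)
  define I where "I m = integral {v..r} (\<lambda>x. (1 - F x) ^ m)" for m
  define t where "t m = real (N choose m) * F v ^ (N - m) * (1 - F v) ^ m * spa_revenue F r m v" for m
  have Fv: "0 < F v" "F v < 1" using F_pos[of v] F_less_1[of v] v by auto
  have y_nonneg: "0 \<le> spa_revenue F r m v" for m
    using cutoff_less_spa_revenue[of v m] v by simp
  have t_eq: "t m = real (N choose m) * F v ^ (N - m) * ((1 - F v) ^ m * v + I m)" for m
    using survival_power_times_spa_revenue[of v m] Fv by (simp add: t_def I_def mult.assoc)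
  have "t n \<le> (\<Sum>m=0..n. t m)"
    by (rule member_le_sum) (use Fv y_nonneg in \<open>auto simp: t_def\<close>)
  then have "t n + t (Suc n) \<le> (\<Sum>m=0..N-1. t m)" by (simp add: n)
  moreover have "t n \<ge> real N * real (N - 1) / 2 * (F v)\<^sup>2 * I n"
  proof -
    have "real (N choose n) = real N * real (N - 1) / 2"
      using binomial_symmetric[of 2 N] N real_of_nat_div[of 2 "N * (N - 1)"]
      by (simp add: choose_two n del: mult_Suc mult_Suc_right of_nat_Suc)
    moreover have "N - n = 2" by (simp add: n)
    ultimately have "t n = real N * real (N - 1) / 2 * (F v)\<^sup>2 * ((1 - F v) ^ n * v + I n)"
      unfolding t_eq by (simp only:)
    also have "\<dots> \<ge> real N * real (N - 1) / 2 * (F v)\<^sup>2 * I n"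
      using Fv v by (intro mult_left_mono) auto
    finally show ?thesis .
  qed
  moreover have "t (Suc n) - real N * F v * spa_price N F r v \<ge> - (real N * real (N - 1) * (F v)\<^sup>2 * v)"
  proof -
    \<comment> \<open>The integrals cancel: \<open>t (Suc n)\<close> carries the coefficient
      \<open>N * F v\<close> and the exponent \<open>N - 1\<close>, exactly as the acquisition cost
      does.\<close>
    have "t (Suc n) - real N * F v * spa_price N F r v = - (real N * F v * v * (1 - (1 - F v) ^ Suc n))"
      unfolding t_eq by (simp add: n spa_price_def I_def algebra_simps)
    moreover have "1 - (1 - F v) ^ Suc n \<le> real (Suc n) * F v"
      using Bernoulli_inequality[of "- F v" "Suc n"] Fv by simp
    then have "real N * F v * v * (1 - (1 - F v) ^ Suc n) \<le> real N * F v * v * (real (Suc n) * F v)"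
      using Fv v by (intro mult_left_mono) auto
    ultimately show ?thesis by (simp add: n power2_eq_square mult_ac)
  qed
  moreover have "spa_profit N F r v = (\<Sum>m=0..N-1. t m) - real N * F v * spa_price N F r v"
    by (simp add: spa_profit_def t_def)
  moreover have "I n = integral {v..r} (\<lambda>x. (1 - F x) ^ (N - 2))" by (simp add: I_def n)
  ultimately show ?thesis by (simp add: right_diff_distrib)
qed

text \<open>As \<open>v\<close> shrinks, the integral stays bounded away from \<open>0\<close> while
  the subtracted \<open>v\<close> does not. Cutting the integral off at \<open>r / 2\<close> ensures
  a positive integrand, since \<open>F (r / 2) < 1\<close>.\<close>

lemma ex_spa_profit_pos:
  assumes "2 \<le> N"
  shows "\<exists>v\<in>{0..r}. 0 < spa_profit N F r v"
proof -
  define q where "q = (1 - F (r / 2)) ^ (N - 2)"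
  have q: "0 < q" "q \<le> 1"
    using F_less_1[of "r / 2"] F_nonneg[of "r / 2"] r_pos by (auto simp: q_def intro: power_le_one)
  define v where "v = r * q / 8"
  have "r * q \<le> r" using q r_pos by (simp add: mult_left_le)
  then have v: "0 < v" "v \<le> r / 8" using q r_pos by (auto simp: v_def)
  \<comment> \<open>\<open>v\<close> is chosen so that \<open>v < (r / 2 - v) q / 2\<close>\<close>
  have "(r / 2 - v) * q \<le> integral {v..r} (\<lambda>x. (1 - F x) ^ (N - 2))"
    using integral_lower_bound[of v "r / 2" 1 "N - 2"] v r_pos by (simp add: q_def)
  moreover have "(r / 2 - r / 8) * q \<le> (r / 2 - v) * q"
    using v q by (intro mult_right_mono) auto
  \<comment> \<open>Half of the integral is thus at least \<open>3 * v / 2\<close>, which exceeds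
    \<open>v\<close>.\<close>
  moreover have "(r / 2 - r / 8) * q = 3 * v" by (simp add: v_def)
  ultimately have "0 < integral {v..r} (\<lambda>x. (1 - F x) ^ (N - 2)) / 2 - v" using v(1) by linarith
  then have "0 < real N * real (N - 1) * (F v)\<^sup>2 * (integral {v..r} (\<lambda>x. (1 - F x) ^ (N - 2)) / 2 - v)"
    using assms F_pos[of v] v r_pos by (intro mult_pos_pos) auto
  also have "\<dots> \<le> spa_profit N F r v"
    using assms v r_pos by (intro spa_profit_lower_bound) auto
  finally show ?thesis using v r_pos by (intro bexI[of _ v]) auto
qed

end

section \<open>Existence and comparison of the maxima\<close>

theorem proposition5:
  fixes N :: nat and r :: real and f F :: "real \<Rightarrow> real"
  assumes N: "N \<ge> 2"
    and r: "0 < r" "r \<le> 1"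
    and f_measurable: "f \<in> borel_measurable borel"
    and f_nonneg: "\<And>x. 0 \<le> f x"
    and f_prob: "prob_space (density lborel (\<lambda>x. ennreal (f x)))"
    and f_supp: "measure (density lborel (\<lambda>x. ennreal (f x))) {0..1} = 1"
    and F_cdf: "F = cdf (density lborel (\<lambda>x. ennreal (f x)))"
    and F_0: "F 0 = 0"
    and F_pos: "\<And>v. 0 < v \<Longrightarrow> v \<le> 1 \<Longrightarrow> 0 < F v"
    and F_less_1: "\<And>v. 0 \<le> v \<Longrightarrow> v < r \<Longrightarrow> F v < 1"
  shows "\<exists>v w. is_arg_max (spa_profit N F r) (\<lambda>u. u \<in> {0..r}) v \<and>
               is_arg_max (fpa_profit N F r) (\<lambda>u. u \<in> {0..r}) w \<and>
               spa_profit N F r v > fpa_profit N F r w"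
proof -
  define M where "M = density lborel (\<lambda>x. ennreal (f x))"
  interpret prob_space M using f_prob by (simp add: M_def)
  interpret real_distribution M by unfold_locales (simp_all add: M_def)
  \<comment> \<open>A measure with a Lebesgue density has no atoms, which \<open>isCont_cdf\<close>
    turns into continuity of \<open>F\<close>.\<close>
  have "emeasure M {x} = 0" for x
  proof -
    have "AE y in lborel. y \<in> {x} \<longrightarrow> ennreal (f y) \<le> 0"
      using AE_lborel_singleton[of x] by eventually_elim simp
    then show ?thesis
      using f_measurable by (simp add: M_def emeasure_density nn_integral_0_iff_AE eventually_mono)
  qed
  then have "isCont F x" for x
    by (simp add: F_cdf M_def[symmetric] isCont_cdf measure_def)
  then have "continuous_on {0..r} F" by (simp add: continuous_at_imp_continuous_on)
  then interpret value_cdf F r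
    using r F_0 F_pos F_less_1 cdf_nondecreasing cdf_bounded_prob
    by unfold_locales (auto simp: F_cdf M_def[symmetric])
  have ne: "{0..r} \<noteq> {}" using r by simp
  obtain v where v: "v \<in> {0..r}" "\<And>u. u \<in> {0..r} \<Longrightarrow> spa_profit N F r u \<le> spa_profit N F r v"
    using continuous_attains_sup[OF compact_Icc ne continuous_on_spa_profit] by blast
  obtain w where w: "w \<in> {0..r}" "\<And>u. u \<in> {0..r} \<Longrightarrow> fpa_profit N F r u \<le> fpa_profit N F r w"
    using continuous_attains_sup[OF compact_Icc ne continuous_on_fpa_profit] by blast
  have "0 < spa_profit N F r v" using ex_spa_profit_pos[OF N] v(2) by force
  \<comment> \<open>At an end point the first-price profit is at most \<open>0\<close>. At an
    interior \<open>w\<close> the second-price profit at the same cutoff is already larger, and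
    \<open>v\<close> does at least as well.\<close>
  then have "fpa_profit N F r w < spa_profit N F r v"
    using fpa_profit_0[OF N] fpa_profit_reserve_nonpos[OF N] fpa_profit_less_spa_profit[OF N, of w]
      v(2)[of w] w(1)
    by (cases "w = 0 \<or> w = r") auto
  moreover have "is_arg_max (spa_profit N F r) (\<lambda>u. u \<in> {0..r}) v"
    and "is_arg_max (fpa_profit N F r) (\<lambda>u. u \<in> {0..r}) w"
    using v w by (auto simp: is_arg_max_def not_less)
  ultimately show ?thesis by blast
qed

end
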